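(* Let $n\ge 2$ and $1\le k\le n-1$ be integers. Then for every $a\in(0;1)$ $$ A^2_{n,k}(a)-A^2_{n-1,k-1}(a)=-(2n-1)\bigl(P_{n-1}^{(k-n)}(a)\bigr)^2 . $$
   Context: For integers $n\ge1$, $0\le k\le n-1$ and $a\in(0;1)$, $A_{n,k}(a):=\sup\{|f^{(k)}(a)| : f\in \mathring{W}_2^n[0;1],\ \int_0^1|f^{(n)}(x)|^2dx\le 1\}$ and $A^2_{n,k}(a)=(A_{n,k}(a))^2$. Here $\mathring{W}_2^n[0;1]$ is the space of functions $f$ on $[0;1]$ whose derivatives up to order $n-1$ are absolutely continuous, with $f^{(n)}\in L_2[0;1]$ and $f^{(j)}(0)=f^{(j)}(1)=0$ for $j=0,\dots,n-1$. The shifted Legendre polynomials are $P_m(x)=\frac1{m!}\frac{d^m}{dx^m}\bigl[(x^2-x)^m\bigr]$, and for $0\le l\le m$ the antiderivative of order $l$ of $P_m$ is defined as $P_m^{(-l)}(x):=\frac{1}{m!}\frac{d^{m-l}}{dx^{m-l}}\bigl[(x^2-x)^m\bigr]$. Thus $P_{n-1}^{(k-n)}(x)=\frac1{(n-1)!}\frac{d^{k-1}}{dx^{k-1}}\bigl[(x^2-x)^{n-1}\bigr]$. *)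

theory Defs
  imports "HOL-Analysis.Analysis"
begin

definition abs_continuous_on :: "real set \<Rightarrow> (real \<Rightarrow> real) \<Rightarrow> bool" where
  "abs_continuous_on S f \<longleftrightarrow>
     (\<forall>\<epsilon>>0. \<exists>\<delta>>0. \<forall>D T. D division_of T \<and> T \<subseteq> S \<and> (\<Sum>K\<in>D. Sup K - Inf K) < \<delta> \<longrightarrow>
        (\<Sum>K\<in>D. \<bar>f (Sup K) - f (Inf K)\<bar>) < \<epsilon>)"

(* One-sided at the endpoints 0 and 1; the value at a point where the derivative does not
   exist is unspecified. Values of f outside [0,1] are irrelevant. *)
primrec deriv01 :: "nat \<Rightarrow> (real \<Rightarrow> real) \<Rightarrow> real \<Rightarrow> real" where
  "deriv01 0 f = f"
| "deriv01 (Suc j) f = (\<lambda>x. vector_derivative (deriv01 j f) (at x within {0..1}))"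

definition L2_01 :: "(real \<Rightarrow> real) set" where
  "L2_01 = {g \<in> borel_measurable (lebesgue_on {0..1}). integrable (lebesgue_on {0..1}) (\<lambda>x. (g x)\<^sup>2)}"

(* Used for n >= 1 only. The derivatives of order up to n-1 exist on all of [0,1], the n-th one
   only almost everywhere; the latter already follows from absolute continuity and is listed
   because the value of deriv01 is unspecified where the derivative does not exist. *)
definition W2_ring :: "nat \<Rightarrow> (real \<Rightarrow> real) set" where
  "W2_ring n = {f.
     (\<forall>j<n - 1. \<forall>x\<in>{0..1}. deriv01 j f differentiable (at x within {0..1})) \<and>
     (\<forall>j<n. abs_continuous_on {0..1} (deriv01 j f)) \<and>
     (AE x in lebesgue_on {0..1}. deriv01 (n - 1) f differentiable (at x within {0..1})) \<and>
     deriv01 n f \<in> L2_01 \<and>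
     (\<forall>j<n. deriv01 j f 0 = 0 \<and> deriv01 j f 1 = 0)}"

(* The supremum is taken in ereal, so that it is the true supremum without presupposing that
   the set is bounded. *)
definition A_const :: "nat \<Rightarrow> nat \<Rightarrow> real \<Rightarrow> ereal" where
  "A_const n k a =
     (SUP f\<in>{f \<in> W2_ring n. (\<integral>x. \<bar>deriv01 n f x\<bar>\<^sup>2 \<partial>lebesgue_on {0..1}) \<le> 1}.
        ereal \<bar>deriv01 k f a\<bar>)"

(* legendre_antideriv m l is the antiderivative of order l of the shifted Legendre polynomial of
   degree m; meant for l <= m (l = 0 is the polynomial itself). *)
definition legendre_antideriv :: "nat \<Rightarrow> nat \<Rightarrow> real \<Rightarrow> real" where
  "legendre_antideriv m l x = 1 / fact m * (deriv ^^ (m - l)) (\<lambda>t. (t\<^sup>2 - t) ^ m) x"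

end

theory Submission
  imports Defs
begin

text \<open>By Taylor's formula \<open>f\<^sup>(\<^sup>k\<^sup>)(a) = \<integral> h f\<^sup>(\<^sup>n\<^sup>)\<close> with the truncated kernel \<open>h(x) = (a - x)\<^sub>+\<^sup>m / m!\<close>,
  \<open>m = n - 1 - k\<close>, and the boundary conditions say exactly that \<open>f\<^sup>(\<^sup>n\<^sup>)\<close> is orthogonal to the
  polynomials of degree less than \<open>n\<close>. So \<open>A\<^sub>n\<^sub>,\<^sub>k(a)\<close> is the \<open>L\<^sub>2\<close>-distance of \<open>h\<close> to these
  polynomials. Passing from \<open>(n - 1, k - 1)\<close> to \<open>(n, k)\<close> leaves \<open>h\<close> unchanged and adds one
  polynomial, \<open>P\<^sub>n\<^sub>-\<^sub>1\<close>, of squared norm \<open>1 / (2n - 1)\<close>; the Fourier coefficient \<open>\<integral> h P\<^sub>n\<^sub>-\<^sub>1\<close> is the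
  antiderivative \<open>P\<^sub>n\<^sub>-\<^sub>1\<^sup>(\<^sup>k\<^sup>-\<^sup>n\<^sup>)(a)\<close>, by Taylor's formula again.\<close>

subsection \<open>Absolutely continuous functions\<close>

lemma abs_continuous_on_subset:
  "abs_continuous_on T f \<Longrightarrow> S \<subseteq> T \<Longrightarrow> abs_continuous_on S f"
  unfolding abs_continuous_on_def by (meson subset_trans)

lemma abs_continuous_onE:
  assumes "abs_continuous_on S f" "0 < \<epsilon>"
  obtains \<delta> where "0 < \<delta>"
    "\<And>D T. D division_of T \<Longrightarrow> T \<subseteq> S \<Longrightarrow> (\<Sum>K\<in>D. Sup K - Inf K) < \<delta>
       \<Longrightarrow> (\<Sum>K\<in>D. \<bar>f (Sup K) - f (Inf K)\<bar>) < \<epsilon>"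
  using assms unfolding abs_continuous_on_def by meson

lemma division_of_real_memD:
  fixes D :: "real set set"
  assumes "D division_of T" "K \<in> D"
  shows "Inf K \<le> Sup K" "Inf K \<in> T" "Sup K \<in> T" "K = {Inf K..Sup K}"
proof -
  obtain u v where K: "K = {u..v}" using assms by (metis division_ofD(4) interval_cbox)
  moreover have ne: "K \<noteq> {}" and sub: "K \<subseteq> T" using assms by (auto dest: division_ofD)
  ultimately have uv: "u \<le> v" "Inf K = u" "Sup K = v" by auto
  then show "Inf K \<le> Sup K" "K = {Inf K..Sup K}" using K by auto
  have "u \<in> K" "v \<in> K" using K uv by auto
  then show "Inf K \<in> T" "Sup K \<in> T" using sub uv by auto
qed

lemma abs_continuous_on_imp_continuous_on:
  assumes "abs_continuous_on {a..b::real} f"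
  shows "continuous_on {a..b} f"
  unfolding continuous_on_iff
proof (intro ballI allI impI)
  fix x e :: real assume x: "x \<in> {a..b}" and e: "0 < e"
  obtain d where d: "0 < d" and *: "\<And>D T. D division_of T \<Longrightarrow> T \<subseteq> {a..b}
      \<Longrightarrow> (\<Sum>K\<in>D. Sup K - Inf K) < d \<Longrightarrow> (\<Sum>K\<in>D. \<bar>f (Sup K) - f (Inf K)\<bar>) < e"
    using abs_continuous_onE[OF assms e] by blast
  have **: "\<bar>f v - f u\<bar> < e" if "u \<le> v" "v - u < d" "u \<in> {a..b}" "v \<in> {a..b}" for u v
    using *[of "{{u..v}}" "{u..v}"] that division_of_self[of u v] by simp
  show "\<exists>d>0. \<forall>x'\<in>{a..b}. dist x' x < d \<longrightarrow> dist (f x') (f x) < e"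
  proof (intro exI conjI ballI impI)
    fix y assume y: "y \<in> {a..b}" "dist y x < d"
    show "dist (f y) (f x) < e"
      using **[of x y] **[of y x] x y by (cases "x \<le> y") (auto simp: dist_real_def abs_minus_commute)
  qed (use d in auto)
qed

lemma lipschitz_imp_abs_continuous_on:
  assumes "\<And>x y. x \<in> S \<Longrightarrow> y \<in> S \<Longrightarrow> \<bar>f x - f y\<bar> \<le> L * \<bar>x - y\<bar>"
  shows "abs_continuous_on S f"
  unfolding abs_continuous_on_def
proof (intro allI impI)
  fix e :: real assume e: "0 < e"
  \<comment> \<open>A strictly positive Lipschitz constant makes the threshold \<open>e / M\<close>
    positive whatever the sign of \<open>L\<close>.\<close>
  define M where "M = \<bar>L\<bar> + 1"
  have M: "M > 0" "L \<le> M" by (auto simp: M_def)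
  show "\<exists>\<delta>>0. \<forall>D T. D division_of T \<and> T \<subseteq> S \<and> (\<Sum>K\<in>D. Sup K - Inf K) < \<delta> \<longrightarrow>
        (\<Sum>K\<in>D. \<bar>f (Sup K) - f (Inf K)\<bar>) < e"
  proof (intro exI[of _ "e / M"] conjI allI impI)
    fix D T assume *: "D division_of T \<and> T \<subseteq> S \<and> (\<Sum>K\<in>D. Sup K - Inf K) < e / M"
    have "(\<Sum>K\<in>D. \<bar>f (Sup K) - f (Inf K)\<bar>) \<le> (\<Sum>K\<in>D. M * (Sup K - Inf K))"
    proof (rule sum_mono)
      fix K assume "K \<in> D"
      note K = division_of_real_memD[OF conjunct1[OF *] this]
      have "\<bar>f (Sup K) - f (Inf K)\<bar> \<le> L * \<bar>Sup K - Inf K\<bar>" using K * by (intro assms) auto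
      also have "\<dots> \<le> M * \<bar>Sup K - Inf K\<bar>" using M by (intro mult_right_mono) auto
      finally show "\<bar>f (Sup K) - f (Inf K)\<bar> \<le> M * (Sup K - Inf K)" using K by simp
    qed
    also have "\<dots> = M * (\<Sum>K\<in>D. Sup K - Inf K)" by (simp add: sum_distrib_left)
    also have "\<dots> < e" using * M by (simp add: field_simps)
    finally show "(\<Sum>K\<in>D. \<bar>f (Sup K) - f (Inf K)\<bar>) < e" .
  qed (use e M in auto)
qed

lemma abs_continuous_on_add:
  assumes "abs_continuous_on S f" "abs_continuous_on S g"
  shows "abs_continuous_on S (\<lambda>x. f x + g x)"
  unfolding abs_continuous_on_def
proof (intro allI impI)
  fix e :: real assume e: "0 < e"
  obtain d1 where d1: "0 < d1" "\<And>D T. D division_of T \<Longrightarrow> T \<subseteq> S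
      \<Longrightarrow> (\<Sum>K\<in>D. Sup K - Inf K) < d1 \<Longrightarrow> (\<Sum>K\<in>D. \<bar>f (Sup K) - f (Inf K)\<bar>) < e/2"
    using abs_continuous_onE[OF assms(1), of "e/2"] e by auto
  obtain d2 where d2: "0 < d2" "\<And>D T. D division_of T \<Longrightarrow> T \<subseteq> S
      \<Longrightarrow> (\<Sum>K\<in>D. Sup K - Inf K) < d2 \<Longrightarrow> (\<Sum>K\<in>D. \<bar>g (Sup K) - g (Inf K)\<bar>) < e/2"
    using abs_continuous_onE[OF assms(2), of "e/2"] e by auto
  show "\<exists>\<delta>>0. \<forall>D T. D division_of T \<and> T \<subseteq> S \<and> (\<Sum>K\<in>D. Sup K - Inf K) < \<delta> \<longrightarrow>
        (\<Sum>K\<in>D. \<bar>f (Sup K) + g (Sup K) - (f (Inf K) + g (Inf K))\<bar>) < e"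
  proof (intro exI[of _ "min d1 d2"] conjI allI impI)
    fix D T assume *: "D division_of T \<and> T \<subseteq> S \<and> (\<Sum>K\<in>D. Sup K - Inf K) < min d1 d2"
    have "(\<Sum>K\<in>D. \<bar>f (Sup K) + g (Sup K) - (f (Inf K) + g (Inf K))\<bar>)
        \<le> (\<Sum>K\<in>D. \<bar>f (Sup K) - f (Inf K)\<bar> + \<bar>g (Sup K) - g (Inf K)\<bar>)"
      by (intro sum_mono) auto
    also have "\<dots> < e" using d1(2)[of D T] d2(2)[of D T] * by (simp add: sum.distrib)
    finally show "(\<Sum>K\<in>D. \<bar>f (Sup K) + g (Sup K) - (f (Inf K) + g (Inf K))\<bar>) < e" .
  qed (use d1 d2 in auto)
qed

lemma abs_continuous_on_sum:
  "(\<And>i. i \<in> I \<Longrightarrow> abs_continuous_on S (f i)) \<Longrightarrow> abs_continuous_on S (\<lambda>x. \<Sum>i\<in>I. f i x)"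
proof (induction I rule: infinite_finite_induct)
  case (insert i I)
  then show ?case by (simp add: abs_continuous_on_add)
qed (auto intro: lipschitz_imp_abs_continuous_on[where L = 0])

text \<open>The increment of the product over an interval is \<open>g (Sup K)\<close> times that of
  \<open>f\<close> plus \<open>f (Inf K)\<close> times that of \<open>g\<close>. The bounds
  \<open>C\<close> and \<open>B\<close> weigh the two sums, whence the tolerances
  \<open>e/(2*C)\<close> and \<open>e/(2*B)\<close>.\<close>

lemma abs_continuous_on_mult:
  assumes "abs_continuous_on S f" "abs_continuous_on S g"
    and "bounded (f ` S)" "bounded (g ` S)"
  shows "abs_continuous_on S (\<lambda>x. f x * g x)"
  unfolding abs_continuous_on_def
proof (intro allI impI)
  fix e :: real assume e: "0 < e"
  obtain B where B: "B > 0" "\<And>x. x \<in> S \<Longrightarrow> \<bar>f x\<bar> \<le> B" using assms(3) by (auto simp: bounded_pos)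
  obtain C where C: "C > 0" "\<And>x. x \<in> S \<Longrightarrow> \<bar>g x\<bar> \<le> C" using assms(4) by (auto simp: bounded_pos)
  obtain d1 where d1: "0 < d1" "\<And>D T. D division_of T \<Longrightarrow> T \<subseteq> S
      \<Longrightarrow> (\<Sum>K\<in>D. Sup K - Inf K) < d1 \<Longrightarrow> (\<Sum>K\<in>D. \<bar>f (Sup K) - f (Inf K)\<bar>) < e/(2*C)"
    using abs_continuous_onE[OF assms(1), of "e/(2*C)"] e C by auto
  obtain d2 where d2: "0 < d2" "\<And>D T. D division_of T \<Longrightarrow> T \<subseteq> S
      \<Longrightarrow> (\<Sum>K\<in>D. Sup K - Inf K) < d2 \<Longrightarrow> (\<Sum>K\<in>D. \<bar>g (Sup K) - g (Inf K)\<bar>) < e/(2*B)"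
    using abs_continuous_onE[OF assms(2), of "e/(2*B)"] e B by auto
  show "\<exists>\<delta>>0. \<forall>D T. D division_of T \<and> T \<subseteq> S \<and> (\<Sum>K\<in>D. Sup K - Inf K) < \<delta> \<longrightarrow>
        (\<Sum>K\<in>D. \<bar>f (Sup K) * g (Sup K) - f (Inf K) * g (Inf K)\<bar>) < e"
  proof (intro exI[of _ "min d1 d2"] conjI allI impI)
    fix D T assume *: "D division_of T \<and> T \<subseteq> S \<and> (\<Sum>K\<in>D. Sup K - Inf K) < min d1 d2"
    have "(\<Sum>K\<in>D. \<bar>f (Sup K) * g (Sup K) - f (Inf K) * g (Inf K)\<bar>)
        \<le> (\<Sum>K\<in>D. C * \<bar>f (Sup K) - f (Inf K)\<bar> + B * \<bar>g (Sup K) - g (Inf K)\<bar>)"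
    proof (rule sum_mono)
      fix K assume "K \<in> D"
      note K = division_of_real_memD[OF conjunct1[OF *] this]
      have "f (Sup K) * g (Sup K) - f (Inf K) * g (Inf K)
          = g (Sup K) * (f (Sup K) - f (Inf K)) + f (Inf K) * (g (Sup K) - g (Inf K))"
        by (simp add: algebra_simps)
      also have "\<bar>\<dots>\<bar> \<le> \<bar>g (Sup K)\<bar> * \<bar>f (Sup K) - f (Inf K)\<bar> + \<bar>f (Inf K)\<bar> * \<bar>g (Sup K) - g (Inf K)\<bar>"
        by (metis abs_mult abs_triangle_ineq)
      also have "\<dots> \<le> C * \<bar>f (Sup K) - f (Inf K)\<bar> + B * \<bar>g (Sup K) - g (Inf K)\<bar>"
        using K * B C by (intro add_mono mult_right_mono) auto
      finally show "\<bar>f (Sup K) * g (Sup K) - f (Inf K) * g (Inf K)\<bar>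
          \<le> C * \<bar>f (Sup K) - f (Inf K)\<bar> + B * \<bar>g (Sup K) - g (Inf K)\<bar>" .
    qed
    also have "\<dots> = C * (\<Sum>K\<in>D. \<bar>f (Sup K) - f (Inf K)\<bar>) + B * (\<Sum>K\<in>D. \<bar>g (Sup K) - g (Inf K)\<bar>)"
      by (simp add: sum.distrib sum_distrib_left)
    also have "\<dots> < C * (e/(2*C)) + B * (e/(2*B))"
      using d1(2)[of D T] d2(2)[of D T] * B C by (intro add_strict_mono mult_strict_left_mono) auto
    also have "\<dots> = e" using B C by simp
    finally show "(\<Sum>K\<in>D. \<bar>f (Sup K) * g (Sup K) - f (Inf K) * g (Inf K)\<bar>) < e" .
  qed (use d1 d2 in auto)
qed

section \<open>The fundamental theorem of calculus for absolutely continuous functions\<close>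

text \<open>Two distinct members of a division meet in a convex set with empty interior, hence in a
  null set, so measure is additive over them. This converts small measure of an open set around the
  exceptional points into small total length.\<close>

lemma sum_length_division_le_measure:
  fixes D :: "real set set"
  assumes D: "D division_of T" and T: "T \<subseteq> U" "U \<in> lmeasurable"
  shows "(\<Sum>K\<in>D. Sup K - Inf K) \<le> measure lebesgue U"
proof -
  have fin: "finite D" using D by auto
  have "(\<Sum>K\<in>D. Sup K - Inf K) = (\<Sum>K\<in>D. measure lebesgue K)"
  proof (rule sum.cong)
    fix K assume "K \<in> D"
    note K = division_of_real_memD[OF D this]
    show "Sup K - Inf K = measure lebesgue K" using K(1) by (subst (3) K(4)) simp
  qed simp
  also have "\<dots> = measure lebesgue (\<Union>D)"
  proof (rule measure_negligible_finite_Union[symmetric, OF fin])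
    show "S \<in> lmeasurable" if "S \<in> D" for S
      using division_of_real_memD(4)[OF D that] by (metis lmeasurable_cbox interval_cbox)
    show "pairwise (\<lambda>S T. negligible (S \<inter> T)) D"
      unfolding pairwise_def
    proof (intro ballI impI)
      fix S T assume ST: "S \<in> D" "T \<in> D" "S \<noteq> T"
      have "interior (S \<inter> T) = {}" using division_ofD(5)[OF D] ST by simp
      moreover have "convex (S \<inter> T)"
        using division_of_real_memD(4)[OF D ST(1)] division_of_real_memD(4)[OF D ST(2)]
        by (metis convex_Int convex_real_interval(5))
      ultimately show "negligible (S \<inter> T)" using negligible_convex_interior by blast
    qed
  qed
  also have "\<dots> \<le> measure lebesgue U"
    using division_ofD(6)[OF D] T D by (intro measure_mono_fmeasurable) (auto intro: fmeasurableD[OF lmeasurable_division])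
  finally show ?thesis .
qed

text \<open>Intervals tagged in the exceptional null set are confined to an open set of small measure,
  where absolute continuity controls the increments of \<open>f\<close>; the other ones are handled by the
  straddle estimate.\<close>
theorem abs_continuous_fundamental_theorem_of_calculus:
  fixes f g :: "real \<Rightarrow> real"
  assumes ab: "a \<le> b" and ac: "abs_continuous_on {a..b} f" and N: "negligible N"
    and der: "\<And>x. x \<in> {a..b} - N \<Longrightarrow> (f has_real_derivative g x) (at x within {a..b})"
  shows "(g has_integral (f b - f a)) {a..b}"
proof -
  \<comment> \<open>With the integrand set to 0 on \<open>N\<close>, tags in \<open>N\<close>
    contribute only increments of \<open>f\<close>; the spike argument at the end restores
    \<open>g\<close>.\<close>
  define h where "h x = (if x \<in> N then 0 else g x)" for x
  have "(h has_integral (f b - f a)) {a..b}"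
    unfolding has_integral_real
  proof (intro allI impI)
    fix e :: real assume e: "0 < e"
    obtain \<delta> where \<delta>: "0 < \<delta>" "\<And>D T. D division_of T \<Longrightarrow> T \<subseteq> {a..b} \<Longrightarrow>
        (\<Sum>K\<in>D. Sup K - Inf K) < \<delta> \<Longrightarrow> (\<Sum>K\<in>D. \<bar>f (Sup K) - f (Inf K)\<bar>) < e/2"
      using abs_continuous_onE[OF ac, of "e/2"] e by auto
    obtain U where U: "open U" "N \<subseteq> U" "U \<in> lmeasurable" "measure lebesgue U < \<delta>"
    proof -
      have Nl: "N \<in> lmeasurable" "measure lebesgue N = 0" using N by (auto simp: negligible_iff_measure)
      obtain V where V: "open V" "N \<subseteq> V" "V - N \<in> lmeasurable" "emeasure lebesgue (V - N) < ennreal \<delta>"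
        using sets_lebesgue_outer_open[of N \<delta>] Nl \<delta> by (auto dest: fmeasurableD)
      have Vu: "V = N \<union> (V - N)" using V by auto
      have "V \<in> lmeasurable" using Nl V(3) Vu by (metis fmeasurable.Un)
      moreover have "measure lebesgue V < \<delta>"
      proof -
        have "measure lebesgue V \<le> measure lebesgue N + measure lebesgue (V - N)"
          using Vu Nl(1) V(3) measure_Un_le fmeasurableD by metis
        also have "\<dots> < \<delta>"
          using V(4) Nl(2) \<delta>(1) emeasure_eq_measure2[OF V(3)] by (simp add: ennreal_less_iff)
        finally show ?thesis .
      qed
      ultimately show ?thesis using that V by blast
    qed
    \<comment> \<open>The lengths sum to \<open>b - a\<close>, so the total straddle error stays
      below \<open>e / 2\<close>; the summand 1 keeps the denominator positive when
      \<open>a = b\<close>.\<close>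
    define e' where "e' = e / (2 * (b - a + 1))"
    have e': "e' > 0" using e ab by (auto simp: e'_def)
    have "\<exists>d>0. x \<in> {a..b} - N \<longrightarrow>
         (\<forall>y\<in>{a..b}. \<bar>y - x\<bar> < d \<longrightarrow> \<bar>f y - f x - (y - x) * g x\<bar> \<le> e' * \<bar>y - x\<bar>)" for x
    proof (cases "x \<in> {a..b} - N")
      case True
      then have "(f has_derivative (\<lambda>h. h * g x)) (at x within {a..b})"
        using der[OF True] by (simp add: has_field_derivative_def mult_commute_abs)
      then show ?thesis using e' unfolding has_derivative_within_alt by auto
    qed (auto intro: exI[of _ 1])
    then obtain d where d: "\<And>x. 0 < d x"
       "\<And>x y. x \<in> {a..b} - N \<Longrightarrow> y \<in> {a..b} \<Longrightarrow> \<bar>y - x\<bar> < d x \<Longrightarrow> \<bar>f y - f x - (y - x) * g x\<bar> \<le> e' * \<bar>y - x\<bar>"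
      by metis
    define \<gamma> where "\<gamma> x = (if x \<in> N then U else ball x (d x))" for x
    show "\<exists>\<gamma>. gauge \<gamma> \<and> (\<forall>\<D>. \<D> tagged_division_of {a..b} \<and> \<gamma> fine \<D> \<longrightarrow>
          norm ((\<Sum>(x, k)\<in>\<D>. measure lborel k *\<^sub>R h x) - (f b - f a)) < e)"
    proof (intro exI[of _ \<gamma>] conjI allI impI)
      show "gauge \<gamma>" unfolding gauge_def \<gamma>_def using U d by auto
      fix p assume p: "p tagged_division_of {a..b} \<and> \<gamma> fine p"
      then have ptag: "p tagged_division_of {a..b}" and fine: "\<gamma> fine p" by auto
      have finp: "finite p" using ptag by auto
      define q where "q = {(x, K) \<in> p. x \<in> N}"
      have qp: "q \<subseteq> p" by (auto simp: q_def)
      have K: "Inf K \<le> x" "x \<le> Sup K" "K = {Inf K..Sup K}" "a \<le> Inf K" "Sup K \<le> b" if "(x, K) \<in> p" for x K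
      proof -
        have "\<exists>u v. K = {u..v}" using tagged_division_ofD(4)[OF ptag that] by auto
        then obtain u v where uv: "K = {u..v}" by auto
        have "x \<in> K" "K \<subseteq> {a..b}" using tagged_division_ofD(2,3)[OF ptag that] by auto
        then show "Inf K \<le> x" "x \<le> Sup K" "K = {Inf K..Sup K}" "a \<le> Inf K" "Sup K \<le> b"
          using uv by auto
      qed
      define t where "t z = (case z of (x, K) \<Rightarrow> measure lborel K * h x - (f (Sup K) - f (Inf K)))" for z
      have eq: "(\<Sum>(x, k)\<in>p. measure lborel k *\<^sub>R h x) - (f b - f a) = sum t p"
        unfolding additive_tagged_division_1[OF ab ptag, of f, symmetric] t_def
        by (simp add: sum_subtractf[symmetric] split_def)
      have split: "sum t p = sum t (p - q) + sum t q"
        using sum.subset_diff[OF qp finp] .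
      have "\<bar>sum t (p - q)\<bar> \<le> (\<Sum>(x, K)\<in>p - q. e' * (Sup K - Inf K))"
      proof (rule order_trans[OF sum_abs], rule sum_mono, safe)
        fix x K assume xK: "(x, K) \<in> p" "(x, K) \<notin> q"
        note KK = K[OF xK(1)]
        have xN: "x \<notin> N" using xK by (auto simp: q_def)
        have sub: "K \<subseteq> ball x (d x)" using fineD[OF fine xK(1)] xN by (simp add: \<gamma>_def)
        have "Inf K \<in> {Inf K..Sup K}" "Sup K \<in> {Inf K..Sup K}" using KK(1,2) by auto
        then have "Inf K \<in> K" "Sup K \<in> K" by (simp_all only: KK(3)[symmetric])
        then have less: "\<bar>Inf K - x\<bar> < d x" "\<bar>Sup K - x\<bar> < d x"
          using sub by (auto simp: dist_real_def abs_minus_commute)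
        have xab: "x \<in> {a..b} - N" "Inf K \<in> {a..b}" "Sup K \<in> {a..b}" using KK(1,2,4,5) xN by auto
        \<comment> \<open>The tag lies between the endpoints of \<open>K\<close>, so the two
          one-sided errors add up to \<open>e' * (Sup K - Inf K)\<close>.\<close>
        have "\<bar>f (Inf K) - f x - (Inf K - x) * g x\<bar> \<le> e' * (x - Inf K)"
            "\<bar>f (Sup K) - f x - (Sup K - x) * g x\<bar> \<le> e' * (Sup K - x)"
          using d(2)[OF xab(1,2) less(1)] d(2)[OF xab(1,3) less(2)] KK(1,2) by simp_all
        then have *: "\<bar>(Sup K - Inf K) * g x - (f (Sup K) - f (Inf K))\<bar> \<le> e' * (Sup K - Inf K)"
          by (simp add: algebra_simps)
        have "measure lborel K = Sup K - Inf K" using order_trans[OF KK(1,2)] by (subst KK(3)) simp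
        then show "\<bar>t (x, K)\<bar> \<le> e' * (Sup K - Inf K)" using * xN by (simp add: t_def h_def)
      qed
      also have "\<dots> \<le> (\<Sum>(x, K)\<in>p. e' * (Sup K - Inf K))"
      proof (rule sum_mono2[OF finp])
        fix z assume "z \<in> p - (p - q)"
        then obtain x L where z: "z = (x, L)" "(x, L) \<in> p" by (cases z) auto
        then show "0 \<le> (case z of (x, K) \<Rightarrow> e' * (Sup K - Inf K))"
          using order_trans[OF K(1,2)[OF z(2)]] e' by simp
      qed auto
      also have "\<dots> = e' * (b - a)"
        using additive_tagged_division_1[OF ab ptag, of "\<lambda>x. x"]
        by (simp add: sum_distrib_left[symmetric] split_def)
      also have "\<dots> < e / 2" using e ab by (simp add: e'_def field_simps)
      finally have 1: "\<bar>sum t (p - q)\<bar> < e / 2" .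
      have qpart: "q tagged_partial_division_of {a..b}"
        using ptag qp by (meson tagged_division_of tagged_partial_division_subset tagged_division_of_def)
      have div: "(snd ` q) division_of \<Union>(snd ` q)" by (rule partial_division_of_tagged_division[OF qpart])
      \<comment> \<open>Passing from a sum over tagged intervals to one over intervals requires a
        summand that vanishes on every box with empty interior. The empty box has no meaningful
        \<open>Sup\<close> and \<open>Inf\<close>, so its value is set to 0; singletons give 0
        anyway.\<close>
      define V where "V K = (if K = {} then 0 else \<bar>f (Sup K) - f (Inf K)\<bar>)" for K
      have neq: "K \<noteq> {}" if "(x, K) \<in> q" for x K
        using tagged_division_ofD(2)[OF ptag, of x K] that qp by auto
      have "\<bar>sum t q\<bar> \<le> (\<Sum>(x, K)\<in>q. \<bar>f (Sup K) - f (Inf K)\<bar>)"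
      proof (rule order_trans[OF sum_abs], rule sum_mono, safe)
        fix x K assume "(x, K) \<in> q"
        then show "\<bar>t (x, K)\<bar> \<le> \<bar>f (Sup K) - f (Inf K)\<bar>" by (auto simp: q_def t_def h_def)
      qed
      also have "\<dots> = (\<Sum>(x, K)\<in>q. V K)"
        using neq by (intro sum.cong) (auto simp: V_def)
      also have "\<dots> = (\<Sum>K\<in>snd ` q. V K)"
      proof (rule sum.over_tagged_division_lemma[OF tagged_partial_division_of_Union_self[OF qpart]])
        fix u v :: real assume "box u v = {}"
        then have "v \<le> u" by auto
        then have "cbox u v = {} \<or> u = v" by auto
        then show "V (cbox u v) = 0" by (auto simp: V_def)
      qed
      also have "\<dots> = (\<Sum>K\<in>snd ` q. \<bar>f (Sup K) - f (Inf K)\<bar>)"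
        using neq by (intro sum.cong) (auto simp: V_def)
      also have "\<dots> < e / 2"
      proof (rule \<delta>(2)[OF div])
        show "\<Union> (snd ` q) \<subseteq> {a..b}" using ptag qp by fastforce
        have "\<Union> (snd ` q) \<subseteq> U" using fineD[OF fine] by (fastforce simp: \<gamma>_def q_def)
        from sum_length_division_le_measure[OF div this U(3)] U(4)
        show "(\<Sum>K\<in>snd ` q. Sup K - Inf K) < \<delta>" by simp
      qed
      finally have 2: "\<bar>sum t q\<bar> < e / 2" .
      show "norm ((\<Sum>(x, k)\<in>p. measure lborel k *\<^sub>R h x) - (f b - f a)) < e"
        unfolding eq split using 1 2 by simp
    qed
  qed
  then show ?thesis by (rule has_integral_spike[OF N, rotated]) (auto simp: h_def)
qed

subsection \<open>Integration by parts along chains of derivatives\<close>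

lemma abs_continuous_on_bounded:
  "abs_continuous_on {a..b::real} f \<Longrightarrow> bounded (f ` {a..b})"
  by (intro compact_imp_bounded compact_continuous_image abs_continuous_on_imp_continuous_on) auto

lemma abs_continuous_on_poly: "abs_continuous_on {a..b::real} (poly p)"
proof (induction p)
  case (pCons c p)
  have id: "abs_continuous_on {a..b} (\<lambda>x. x)"
    by (rule lipschitz_imp_abs_continuous_on[where L = 1]) auto
  have "abs_continuous_on {a..b} (\<lambda>x. c + x * poly p x)"
    by (intro abs_continuous_on_add abs_continuous_on_mult id pCons abs_continuous_on_bounded)
       (auto intro: lipschitz_imp_abs_continuous_on[where L = 0])
  then show ?case by (simp add: fun_eq_iff)
qed (auto intro: lipschitz_imp_abs_continuous_on[where L = 0])

lemma has_real_derivative_poly_within: "(poly p has_real_derivative poly (pderiv p) x) (at x within S)"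
  using poly_DERIV has_field_derivative_at_within by blast

lemma higher_pderiv_eq_0: "degree p < n \<Longrightarrow> (pderiv ^^ n) (p :: real poly) = 0"
proof (induction n arbitrary: p)
  case (Suc n)
  show ?case
  proof (cases "degree p = 0")
    case True
    then have "pderiv p = 0" by (simp add: pderiv_eq_0_iff)
    then show ?thesis by (simp only: funpow_Suc_right o_apply higher_pderiv_0)
  next
    case False
    then have "degree (pderiv p) < n" using Suc.prems by (simp add: degree_pderiv)
    then show ?thesis using Suc.IH by (simp only: funpow_Suc_right o_apply)
  qed
qed simp

text \<open>\<open>F 0, \<dots>, F (n - 1)\<close> play the role of the derivatives of order \<open>0, \<dots>, n - 1\<close> of
  a function with zero initial data, and \<open>u\<close> that of the \<open>n\<close>-th derivative.\<close>

definition deriv_chain :: "nat \<Rightarrow> (nat \<Rightarrow> real \<Rightarrow> real) \<Rightarrow> (real \<Rightarrow> real) \<Rightarrow> bool" where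
  "deriv_chain n F u \<longleftrightarrow>
     (\<forall>j<n. abs_continuous_on {0..1} (F j) \<and> F j 0 = 0) \<and>
     (\<forall>j. Suc j < n \<longrightarrow> (\<forall>x\<in>{0..1}. (F j has_real_derivative F (Suc j) x) (at x within {0..1}))) \<and>
     (\<exists>N. negligible N \<and>
        (\<forall>x\<in>{0..1} - N. (F (n - 1) has_real_derivative u x) (at x within {0..1})))"

text \<open>This is \<open>n\<close>-fold integration by parts in one step. The alternating sum
  \<open>G\<close> is absolutely continuous and vanishes at 0; off a null set its derivative
  telescopes to \<open>poly p x * u x\<close>, because the \<open>n\<close>-th derivative of
  \<open>p\<close> is zero.\<close>

lemma deriv_chain_has_integral_poly_mult:
  fixes p :: "real poly"
  assumes F: "deriv_chain n F u" and p: "degree p < n" and b: "b \<in> {0..1}"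
  shows "((\<lambda>x. poly p x * u x) has_integral
           (\<Sum>i<n. (-1) ^ i * poly ((pderiv ^^ i) p) b * F (n - 1 - i) b)) {0..b}"
proof -
  define G where "G x = (\<Sum>i<n. (-1) ^ i * poly ((pderiv ^^ i) p) x * F (n - 1 - i) x)" for x
  obtain N where N: "negligible N"
    "\<And>x. x \<in> {0..1} - N \<Longrightarrow> (F (n - 1) has_real_derivative u x) (at x within {0..1})"
    using F unfolding deriv_chain_def by blast
  have ac: "\<And>j. j < n \<Longrightarrow> abs_continuous_on {0..1} (F j)" "\<And>j. j < n \<Longrightarrow> F j 0 = 0"
    and der: "\<And>j x. Suc j < n \<Longrightarrow> x \<in> {0..1} \<Longrightarrow>
       (F j has_real_derivative F (Suc j) x) (at x within {0..1})"
    using F unfolding deriv_chain_def by auto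
  have acG: "abs_continuous_on {0..1} G"
    unfolding G_def
  proof (intro abs_continuous_on_sum)
    fix i assume i: "i \<in> {..<n}"
    have "abs_continuous_on {0..1} (\<lambda>x. poly (smult ((-1) ^ i) ((pderiv ^^ i) p)) x * F (n - 1 - i) x)"
      using i by (intro abs_continuous_on_mult abs_continuous_on_poly ac abs_continuous_on_bounded) auto
    then show "abs_continuous_on {0..1} (\<lambda>x. (-1) ^ i * poly ((pderiv ^^ i) p) x * F (n - 1 - i) x)"
      by simp
  qed
  have derG: "(G has_real_derivative poly p x * u x) (at x within {0..1})" if x: "x \<in> {0..1} - N" for x
  proof -
    \<comment> \<open>\<open>F' n\<close> stands for \<open>u x\<close>, so the highest derivative
      fits the common pattern and each summand of \<open>G\<close> has derivative
      \<open>T i - T (Suc i)\<close>.\<close>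
    define F' where "F' j = (if j = n then u x else F j x)" for j
    define T where "T i = (-1) ^ i * poly ((pderiv ^^ i) p) x * F' (n - i)" for i
    have "((\<lambda>x. (-1) ^ i * poly ((pderiv ^^ i) p) x * F (n - 1 - i) x) has_real_derivative T i - T (Suc i))
        (at x within {0..1})" if i: "i < n" for i
    proof -
      have d: "(F (n - 1 - i) has_real_derivative F' (n - i)) (at x within {0..1})"
      proof (cases i)
        case 0
        then show ?thesis using N(2)[OF x] i by (simp add: F'_def)
      next
        case (Suc k)
        then have "Suc (n - 1 - i) = n - i" using i by simp
        then show ?thesis using der[of "n - 1 - i" x] x i Suc by (simp add: F'_def)
      qed
      have F'1: "F' (n - Suc i) = F (n - Suc i) x" using i by (auto simp: F'_def)
      show ?thesis
        by (rule derivative_eq_intros has_real_derivative_poly_within d refl)+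
           (simp add: T_def F'1 algebra_simps)
    qed
    then have "(G has_real_derivative (\<Sum>i<n. T i - T (Suc i))) (at x within {0..1})"
      unfolding G_def by (intro DERIV_sum) auto
    moreover have "(\<Sum>i<n. T i - T (Suc i)) = T 0 - T n" by (rule sum_lessThan_telescope')
    moreover have "T n = 0" using higher_pderiv_eq_0[OF p] by (simp add: T_def)
    moreover have "T 0 = poly p x * u x" by (simp add: T_def F'_def)
    ultimately show ?thesis by simp
  qed
  have "((\<lambda>x. poly p x * u x) has_integral (G b - G 0)) {0..b}"
  proof (rule abs_continuous_fundamental_theorem_of_calculus[OF _ _ N(1)])
    show "abs_continuous_on {0..b} G" using b by (intro abs_continuous_on_subset[OF acG]) auto
    show "(G has_real_derivative poly p x * u x) (at x within {0..b})" if "x \<in> {0..b} - N" for x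
      using that b by (intro DERIV_subset[OF derG]) auto
  qed (use b in auto)
  moreover have "G 0 = 0" using ac(2) by (simp add: G_def)
  ultimately show ?thesis by (simp add: G_def)
qed

section \<open>Taylor's formula along a chain\<close>

definition taylor_poly :: "nat \<Rightarrow> real \<Rightarrow> real poly" where
  "taylor_poly m b = smult (1 / fact m) ([:b, -1:] ^ m)"

lemma poly_taylor_poly: "poly (taylor_poly m b) x = (b - x) ^ m / fact m"
  by (simp add: taylor_poly_def)

lemma degree_taylor_poly: "degree (taylor_poly m b) = m"
  by (simp add: taylor_poly_def degree_power_eq)

lemma pderiv_taylor_poly:
  "pderiv (taylor_poly 0 b) = 0" "pderiv (taylor_poly (Suc m) b) = - taylor_poly m b"
  by (auto simp: taylor_poly_def pderiv_smult pderiv_power_Suc pderiv_pCons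
        simp del: power_Suc of_nat_Suc)

lemma higher_pderiv_taylor_poly:
  "i \<le> m \<Longrightarrow> (pderiv ^^ i) (taylor_poly m b) = smult ((-1) ^ i) (taylor_poly (m - i) b)"
proof (induction i)
  case (Suc i)
  then have "m - i = Suc (m - Suc i)" by simp
  then show ?case using Suc by (simp add: pderiv_smult pderiv_taylor_poly)
qed simp

text \<open>At \<open>b\<close> every derivative of the Taylor polynomial vanishes except that of
  order \<open>m\<close>, which equals (-1)^m, so a single boundary term survives. With
  \<open>m = n - 1 - j\<close> this recovers \<open>F j b\<close> from \<open>u\<close>.\<close>

lemma deriv_chain_taylor:
  assumes F: "deriv_chain n F u" and m: "m < n" and b: "b \<in> {0..1}"
  shows "((\<lambda>x. poly (taylor_poly m b) x * u x) has_integral F (n - 1 - m) b) {0..b}"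
proof -
  have "(-1) ^ i * poly ((pderiv ^^ i) (taylor_poly m b)) b = (if i = m then 1 else 0)" for i
  proof (cases "i \<le> m")
    case True
    then show ?thesis by (auto simp: higher_pderiv_taylor_poly poly_taylor_poly power_0_left
        power_mult_distrib[symmetric] mult.assoc[symmetric])
  qed (simp add: higher_pderiv_eq_0 degree_taylor_poly)
  then have "(\<Sum>i<n. (-1) ^ i * poly ((pderiv ^^ i) (taylor_poly m b)) b * F (n - 1 - i) b)
     = (\<Sum>i<n. if i = m then F (n - 1 - i) b else 0)"
    by (intro sum.cong) auto
  also have "\<dots> = F (n - 1 - m) b" using m by simp
  finally show ?thesis
    using deriv_chain_has_integral_poly_mult[OF F _ b, of "taylor_poly m b"] m
    by (simp add: degree_taylor_poly)
qed

lemma deriv_chain_orthogonal_poly: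
  fixes p :: "real poly"
  assumes F: "deriv_chain n F u" and F1: "\<And>j. j < n \<Longrightarrow> F j 1 = 0" and p: "degree p < n"
  shows "((\<lambda>x. poly p x * u x) has_integral 0) {0..1}"
  using deriv_chain_has_integral_poly_mult[OF F p, of 1] F1 p by simp

subsection \<open>Shifted Legendre polynomials\<close>

text \<open>This is the \<open>m\<close>-fold antiderivative of the Legendre polynomial. The
  antiderivatives of lower order are derivatives of this one polynomial and form the chain to which
  Taylor's formula is applied.\<close>

definition legendre_base :: "nat \<Rightarrow> real poly" where
  "legendre_base m = smult (1 / fact m) ([:0, -1, 1:] ^ m)"

definition legendre :: "nat \<Rightarrow> real poly" where
  "legendre m = (pderiv ^^ m) (legendre_base m)"

lemma deriv_funpow_poly: "(deriv ^^ j) (poly p) = poly ((pderiv ^^ j) (p :: real poly))"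
  by (induction j) (auto intro!: DERIV_imp_deriv)

lemma legendre_antideriv_eq_poly:
  "legendre_antideriv m l x = poly ((pderiv ^^ (m - l)) (legendre_base m)) x"
proof -
  have "(\<lambda>t::real. (t\<^sup>2 - t) ^ m) = poly ([:0, -1, 1:] ^ m)"
    by (simp add: fun_eq_iff power2_eq_square algebra_simps)
  then show ?thesis
    by (simp add: legendre_antideriv_def deriv_funpow_poly legendre_base_def higher_pderiv_smult)
qed

text \<open>Each differentiation removes one factor x - c and, at c, multiplies the cofactor by the
  current exponent. Carrying that value along gives both the vanishing at an endpoint for
  \<open>j < m\<close> and the value there for \<open>j = m\<close>.\<close>

lemma higher_pderiv_linear_power_mult:
  fixes q :: "real poly"
  assumes "j \<le> m"
  shows "\<exists>r. (pderiv ^^ j) ([:- c, 1:] ^ m * q) = [:- c, 1:] ^ (m - j) * r \<and>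
             fact (m - j) * poly r c = fact m * poly q c"
  using assms
proof (induction j)
  case (Suc j)
  define i where "i = m - Suc j"
  have i: "m - j = Suc i" using Suc.prems by (simp add: i_def)
  obtain r where r: "(pderiv ^^ j) ([:- c, 1:] ^ m * q) = [:- c, 1:] ^ Suc i * r"
     "fact (Suc i) * poly r c = fact m * poly q c"
    using Suc i by auto
  define w where "w = [:- c, 1:]"
  have w': "pderiv w = 1" by (simp add: w_def pderiv_pCons one_pCons)
  have "(pderiv ^^ Suc j) ([:- c, 1:] ^ m * q) = pderiv (w ^ Suc i * r)"
    using r(1) by (simp add: w_def del: power_Suc)
  also have "\<dots> = w ^ i * (smult (of_nat (Suc i)) r + w * pderiv r)"
    by (simp only: pderiv_mult pderiv_power_Suc w') (simp add: algebra_simps del: of_nat_Suc)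
  finally have "(pderiv ^^ Suc j) ([:- c, 1:] ^ m * q)
      = [:- c, 1:] ^ i * (smult (of_nat (Suc i)) r + [:- c, 1:] * pderiv r)"
    unfolding w_def .
  moreover have "fact i * poly (smult (of_nat (Suc i)) r + [:- c, 1:] * pderiv r) c = fact m * poly q c"
    using r(2) by (simp add: algebra_simps)
  ultimately show ?case unfolding i_def by blast
qed (auto intro: exI[of _ q])

lemma legendre_base_factor:
  "legendre_base m = [:- 0, 1:] ^ m * smult (1 / fact m) ([:- 1, 1:] ^ m)"
  "legendre_base m = [:- 1, 1:] ^ m * smult (1 / fact m) ([:0, 1:] ^ m)"
  by (simp_all add: legendre_base_def power_mult_distrib[symmetric])

lemma higher_pderiv_legendre_base_boundary:
  assumes "j < m"
  shows "poly ((pderiv ^^ j) (legendre_base m)) 0 = 0" "poly ((pderiv ^^ j) (legendre_base m)) 1 = 0"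
proof -
  show "poly ((pderiv ^^ j) (legendre_base m)) 0 = 0"
    using higher_pderiv_linear_power_mult[of j m 0 "smult (1 / fact m) ([:- 1, 1:] ^ m)"] assms
    unfolding legendre_base_factor(1)[symmetric] by auto
  show "poly ((pderiv ^^ j) (legendre_base m)) 1 = 0"
    using higher_pderiv_linear_power_mult[of j m 1 "smult (1 / fact m) ([:0, 1:] ^ m)"] assms
    unfolding legendre_base_factor(2)[symmetric] by auto
qed

text \<open>In the case \<open>j = m\<close>, \<open>c = 1\<close> the cofactor takes the value 1 /
  m! at 1, which cancels against \<open>fact m\<close>.\<close>

lemma poly_legendre_1: "poly (legendre m) 1 = 1"
  using higher_pderiv_linear_power_mult[of m m 1 "smult (1 / fact m) ([:0, 1:] ^ m)"]
  unfolding legendre_base_factor(2)[symmetric] by (auto simp: legendre_def)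

lemma degree_legendre: "degree (legendre m) = m"
  by (simp add: legendre_def legendre_base_def degree_higher_pderiv degree_power_eq)

lemma lead_coeff_legendre_nonzero: "coeff (legendre m) m \<noteq> 0"
  by (metis degree_legendre leading_coeff_0_iff poly_0 poly_legendre_1 zero_neq_one)

text \<open>The base polynomial has a zero of order \<open>m\<close> at 0, so its derivatives form a
  chain ending in the Legendre polynomial. Orthogonality and Taylor's formula thus apply to it just
  as to functions of the space.\<close>

lemma legendre_deriv_chain:
  assumes "m > 0"
  shows "deriv_chain m (\<lambda>j. poly ((pderiv ^^ j) (legendre_base m))) (poly (legendre m))"
proof -
  have "(poly ((pderiv ^^ (m - 1)) (legendre_base m)) has_real_derivative poly (legendre m) x)
      (at x within {0..1})" for x
    using has_real_derivative_poly_within[of "(pderiv ^^ (m - 1)) (legendre_base m)" x] assms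
    by (cases m) (auto simp: legendre_def)
  then show ?thesis
    using has_real_derivative_poly_within[of "(pderiv ^^ j) (legendre_base m)" for j]
    unfolding deriv_chain_def
    by (auto simp: abs_continuous_on_poly higher_pderiv_legendre_base_boundary)
qed

lemma legendre_orthogonal_poly:
  "degree p < m \<Longrightarrow> ((\<lambda>x. poly p x * poly (legendre m) x) has_integral 0) {0..1}"
  by (rule deriv_chain_orthogonal_poly[OF legendre_deriv_chain])
     (auto simp: higher_pderiv_legendre_base_boundary)

lemma legendre_orthogonal:
  assumes "i \<noteq> j"
  shows "((\<lambda>x. poly (legendre i) x * poly (legendre j) x) has_integral 0) {0..1}"
proof (cases "i < j")
  case True
  then show ?thesis by (intro legendre_orthogonal_poly) (simp add: degree_legendre)
next
  case False
  then have "((\<lambda>x. poly (legendre j) x * poly (legendre i) x) has_integral 0) {0..1}"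
    using assms by (intro legendre_orthogonal_poly) (simp add: degree_legendre)
  then show ?thesis by (simp add: mult.commute)
qed

lemma legendre_norm:
  "((\<lambda>x. poly (legendre m) x * poly (legendre m) x) has_integral (1 / (2 * m + 1))) {0..1}"
proof -
  \<comment> \<open>Euler's operator \<open>x d/dx\<close> multiplies the leading term by \<open>m\<close>, so \<open>(x L\<^sup>2)' = (2m + 1) L\<^sup>2 + 2 R L\<close>
    with \<open>R\<close> of lower degree.\<close>
  define L where "L = legendre m"
  define R where "R = [:0, 1:] * pderiv L - smult (of_nat m) L"
  have coeff: "coeff R k = (real k - real m) * coeff L k" for k
    unfolding R_def by (cases k) (auto simp: coeff_pderiv algebra_simps)
  have RL: "((\<lambda>x. poly R x * poly L x) has_integral 0) {0..1}"
  proof (cases "R = 0")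
    case False
    have "degree R \<le> m" by (rule degree_le) (auto simp: coeff L_def degree_legendre coeff_eq_0)
    moreover have "degree R \<noteq> m" using coeff[of m] False by (metis diff_self leading_coeff_0_iff mult_zero_left)
    ultimately show ?thesis unfolding L_def by (intro legendre_orthogonal_poly) simp
  qed simp
  \<comment> \<open>The factor x removes the boundary term at 0, and the value 1 of \<open>L\<close>
    at 1 makes the total 1.\<close>
  have "((\<lambda>x. (2 * m + 1) * (poly L x * poly L x) + 2 * (poly R x * poly L x)) has_integral
     (1 * (poly L 1 * poly L 1) - 0 * (poly L 0 * poly L 0))) {0..1}"
  proof (rule fundamental_theorem_of_calculus)
    fix x :: real
    have xL: "x * poly (pderiv L) x = poly R x + m * poly L x" by (simp add: R_def)
    have "poly L x * poly L x + x * (poly (pderiv L) x * poly L x + poly (pderiv L) x * poly L x)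
       = poly L x * poly L x + 2 * (x * poly (pderiv L) x) * poly L x" by simp
    then have eq: "poly L x * poly L x + x * (poly (pderiv L) x * poly L x + poly (pderiv L) x * poly L x)
       = (2 * m + 1) * (poly L x * poly L x) + 2 * (poly R x * poly L x)"
      unfolding xL by (simp add: algebra_simps)
    have "((\<lambda>x. x * (poly L x * poly L x)) has_real_derivative
        poly L x * poly L x + x * (poly (pderiv L) x * poly L x + poly (pderiv L) x * poly L x)) (at x within {0..1})"
      by (rule derivative_eq_intros has_real_derivative_poly_within refl)+ (simp add: algebra_simps)
    then show "((\<lambda>x. x * (poly L x * poly L x)) has_vector_derivative
       (2 * m + 1) * (poly L x * poly L x) + 2 * (poly R x * poly L x)) (at x within {0..1})"
      unfolding eq has_real_derivative_iff_has_vector_derivative .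
  qed simp
  from has_integral_diff[OF this has_integral_mult_right[OF RL, of 2]]
  have "((\<lambda>x. (2 * m + 1) * (poly L x * poly L x)) has_integral 1) {0..1}"
    by (simp add: L_def poly_legendre_1)
  from has_integral_mult_right[OF this, of "1 / (2 * m + 1)"]
  show ?thesis by (simp add: L_def divide_simps add_eq_0_iff add.commute split: if_splits)
qed

lemma legendre_span:
  "degree p < n \<Longrightarrow> \<exists>c. p = (\<Sum>j<n. smult (c j) (legendre j))"
proof (induction n arbitrary: p)
  case (Suc n)
  define b where "b = coeff p n / coeff (legendre n) n"
  define q where "q = p - smult b (legendre n)"
  have "degree q \<le> n" using Suc.prems unfolding q_def
    by (intro degree_diff_le) (auto simp: degree_legendre)
  moreover have "coeff q n = 0" using lead_coeff_legendre_nonzero[of n] by (simp add: q_def b_def)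
  ultimately have q: "q = 0 \<or> degree q < n" by (metis le_neq_implies_less leading_coeff_0_iff)
  have "\<exists>c. q = (\<Sum>j<n. smult (c j) (legendre j))"
  proof (cases "q = 0")
    case True
    then show ?thesis by (intro exI[of _ "\<lambda>_. 0"]) simp
  qed (use q Suc.IH in auto)
  then obtain c where c: "q = (\<Sum>j<n. smult (c j) (legendre j))" by blast
  have "p = q + smult b (legendre n)" by (simp add: q_def)
  also have "\<dots> = (\<Sum>j<Suc n. smult ((c(n := b)) j) (legendre j))" by (simp add: c)
  finally show ?case by blast
qed simp

subsection \<open>The kernel and its distance to the polynomials\<close>

abbreviation inner01 :: "(real \<Rightarrow> real) \<Rightarrow> (real \<Rightarrow> real) \<Rightarrow> real" where
  "inner01 f g \<equiv> (\<integral>x. f x * g x \<partial>lebesgue_on {0..1})"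

lemma L2_01_mult_integrable:
  assumes "f \<in> L2_01" "g \<in> L2_01"
  shows "integrable (lebesgue_on {0..1}) (\<lambda>x. f x * g x)"
proof (rule Bochner_Integration.integrable_bound)
  show "integrable (lebesgue_on {0..1}) (\<lambda>x. (f x)\<^sup>2 + (g x)\<^sup>2)"
    using assms by (auto simp: L2_01_def)
  show "(\<lambda>x. f x * g x) \<in> borel_measurable (lebesgue_on {0..1})"
    using assms by (auto simp: L2_01_def)
  show "AE x in lebesgue_on {0..1}. norm (f x * g x) \<le> norm ((f x)\<^sup>2 + (g x)\<^sup>2)"
  proof (rule AE_I2)
    fix x
    have "2 * \<bar>f x * g x\<bar> \<le> (f x)\<^sup>2 + (g x)\<^sup>2"
      using sum_squares_bound[of "\<bar>f x\<bar>" "\<bar>g x\<bar>"] by (simp add: abs_mult)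
    then show "norm (f x * g x) \<le> norm ((f x)\<^sup>2 + (g x)\<^sup>2)" by simp
  qed
qed

lemma L2_01_diff:
  assumes "f \<in> L2_01" "g \<in> L2_01"
  shows "(\<lambda>x. f x - g x) \<in> L2_01"
  using assms L2_01_mult_integrable[OF assms] by (auto simp: L2_01_def power2_diff mult.assoc)

lemma L2_01_cmult: "f \<in> L2_01 \<Longrightarrow> (\<lambda>x. c * f x) \<in> L2_01"
  by (auto simp: L2_01_def power_mult_distrib)

lemma bounded_measurable_L2_01:
  assumes "f \<in> borel_measurable (lebesgue_on {0..1})" "\<And>x. x \<in> {0..1} \<Longrightarrow> \<bar>f x\<bar> \<le> B"
  shows "f \<in> L2_01"
proof -
  have "integrable (lebesgue_on {0..1}) (\<lambda>x. (f x)\<^sup>2)"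
  proof (rule measurable_bounded_by_integrable_imp_lebesgue_integrable)
    show "integrable (lebesgue_on {0..1}) (\<lambda>x::real. B\<^sup>2)"
      by (rule continuous_imp_integrable_real) simp
    show "norm ((f x)\<^sup>2) \<le> B\<^sup>2" if "x \<in> {0..1}" for x
      using assms(2)[OF that] power_mono[of "\<bar>f x\<bar>" B 2] by simp
  qed (use assms in auto)
  then show ?thesis using assms by (simp add: L2_01_def)
qed

lemma poly_measurable_01: "poly p \<in> borel_measurable (lebesgue_on {0..1})" for p :: "real poly"
  by (intro continuous_imp_measurable_on_sets_lebesgue continuous_intros) auto

lemma poly_bounded_01:
  obtains B where "\<And>x. x \<in> {0..1::real} \<Longrightarrow> \<bar>poly p x\<bar> \<le> B"
  using abs_continuous_on_bounded[OF abs_continuous_on_poly[of 0 1 p]] unfolding bounded_iff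
  by (auto simp del: atLeastAtMost_iff)

lemma poly_L2_01: "poly p \<in> L2_01"
  by (rule poly_bounded_01[of p]) (rule bounded_measurable_L2_01[OF poly_measurable_01])

lemma inner01_eqI:
  assumes "f \<in> L2_01" "g \<in> L2_01" "((\<lambda>x. f x * g x) has_integral c) {0..1}"
  shows "inner01 f g = c"
  using has_integral_integral_lebesgue_on[OF L2_01_mult_integrable[OF assms(1,2)]] assms(3)
  by (auto intro: has_integral_unique)

lemma inner01_diff_left:
  assumes "f \<in> L2_01" "g \<in> L2_01" "h \<in> L2_01"
  shows "inner01 (\<lambda>x. f x - g x) h = inner01 f h - inner01 g h"
  using L2_01_mult_integrable[OF assms(1,3)] L2_01_mult_integrable[OF assms(2,3)]
  by (simp add: left_diff_distrib)

lemma inner01_poly_sum_left: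
  assumes "h \<in> L2_01"
  shows "inner01 (poly (\<Sum>j\<in>J. smult (c j) (p j))) h = (\<Sum>j\<in>J. c j * inner01 (poly (p j)) h)"
proof -
  have "inner01 (poly (\<Sum>j\<in>J. smult (c j) (p j))) h
      = (\<integral>x. (\<Sum>j\<in>J. c j * (poly (p j) x * h x)) \<partial>lebesgue_on {0..1})"
    by (simp add: poly_sum sum_distrib_right mult.assoc)
  then show ?thesis using L2_01_mult_integrable[OF poly_L2_01 assms] by simp
qed

text \<open>Expand the squared norm of \<open>v - t * u\<close> at \<open>t = inner01 v u\<close>.
  With the norm of \<open>u\<close> at most 1 it is bounded by \<open>inner01 v v - t^2\<close>; no
  division by a possibly zero norm occurs.\<close>

lemma inner01_bessel:
  assumes "u \<in> L2_01" "v \<in> L2_01" "inner01 u u \<le> 1"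
  shows "(inner01 v u)\<^sup>2 \<le> inner01 v v"
proof -
  define t where "t = inner01 v u"
  have int: "integrable (lebesgue_on {0..1}) (\<lambda>x. v x * v x)"
    "integrable (lebesgue_on {0..1}) (\<lambda>x. v x * u x)"
    "integrable (lebesgue_on {0..1}) (\<lambda>x. u x * u x)"
    by (intro L2_01_mult_integrable assms)+
  have "0 \<le> (\<integral>x. (v x - t * u x) * (v x - t * u x) \<partial>lebesgue_on {0..1})"
    by (intro Bochner_Integration.integral_nonneg) simp
  also have "\<dots> = (\<integral>x. v x * v x - 2 * t * (v x * u x) + t\<^sup>2 * (u x * u x) \<partial>lebesgue_on {0..1})"
    by (intro Bochner_Integration.integral_cong) (auto simp: algebra_simps power2_eq_square)
  also have "\<dots> = inner01 v v - 2 * t * t + t\<^sup>2 * inner01 u u"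
    using int by (simp add: t_def)
  also have "\<dots> \<le> inner01 v v - 2 * t * t + t\<^sup>2 * 1"
    using assms(3) by (intro add_left_mono mult_left_mono) auto
  finally show ?thesis by (simp add: t_def power2_eq_square)
qed

section \<open>The truncated Taylor kernel\<close>

definition truncated_taylor :: "nat \<Rightarrow> real \<Rightarrow> real \<Rightarrow> real" where
  "truncated_taylor m a x = (if x \<le> a then poly (taylor_poly m a) x else 0)"

lemma truncated_taylor_bounded_01:
  obtains B where "\<And>x. x \<in> {0..1} \<Longrightarrow> \<bar>truncated_taylor m a x\<bar> \<le> B"
proof -
  obtain B where B: "\<And>x. x \<in> {0..1} \<Longrightarrow> \<bar>poly (taylor_poly m a) x\<bar> \<le> B"
    using poly_bounded_01 by blast
  have "\<bar>truncated_taylor m a x\<bar> \<le> B" if "x \<in> {0..1}" for x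
    using B[OF that] by (auto simp: truncated_taylor_def)
  then show ?thesis using that by blast
qed

lemma truncated_taylor_L2_01: "truncated_taylor m a \<in> L2_01"
proof -
  obtain B where B: "\<And>x. x \<in> {0..1} \<Longrightarrow> \<bar>truncated_taylor m a x\<bar> \<le> B"
    using truncated_taylor_bounded_01 by blast
  have "{x \<in> space (lebesgue_on {0..1}). x \<le> a} \<in> sets (lebesgue_on {0..1})"
  proof -
    have "{x \<in> space (lebesgue_on {0..1}). x \<le> a} = {0..1} \<inter> {..a}" by auto
    then show ?thesis by (simp add: sets_restrict_space_iff)
  qed
  then have "truncated_taylor m a \<in> borel_measurable (lebesgue_on {0..1})"
    unfolding truncated_taylor_def using poly_measurable_01 by (intro measurable_If) auto
  then show ?thesis using B by (rule bounded_measurable_L2_01)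
qed

text \<open>For \<open>m = 0\<close> the kernel jumps from 1 to 0 at \<open>a\<close>, hence the
  restriction to other points. For the same reason the extremal function has its top derivative
  under control only off \<open>a\<close>.\<close>

lemma truncated_taylor_isCont:
  assumes "x \<noteq> a"
  shows "isCont (truncated_taylor m a) x"
proof (cases "x < a")
  case True
  have "eventually (\<lambda>y. truncated_taylor m a y = poly (taylor_poly m a) y) (nhds x)"
    using eventually_nhds_in_open[of "{..<a}" x] True
    by (auto elim!: eventually_mono simp: truncated_taylor_def)
  then show ?thesis by (simp add: isCont_cong)
next
  case False
  then have "eventually (\<lambda>y. truncated_taylor m a y = 0) (nhds x)"
    using eventually_nhds_in_open[of "{a<..}" x] assms
    by (auto elim!: eventually_mono simp: truncated_taylor_def)
  then show ?thesis by (simp add: isCont_cong)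
qed

text \<open>The truncation cuts the integral down to [0, a], where Taylor's formula at
  \<open>a\<close> applies.\<close>

lemma deriv_chain_inner01_truncated_taylor:
  assumes "deriv_chain n F u" "m < n" "0 < a" "a < 1" "u \<in> L2_01"
  shows "inner01 (truncated_taylor m a) u = F (n - 1 - m) a"
proof (rule inner01_eqI[OF truncated_taylor_L2_01 assms(5)])
  have "((\<lambda>x. if x \<in> {0..a} then poly (taylor_poly m a) x * u x else 0) has_integral F (n - 1 - m) a) {0..1}"
    using deriv_chain_taylor[OF assms(1,2), of a] assms(3,4) by (subst has_integral_restrict) auto
  then show "((\<lambda>x. truncated_taylor m a x * u x) has_integral F (n - 1 - m) a) {0..1}"
    by (rule has_integral_eq[rotated]) (auto simp: truncated_taylor_def)
qed

definition legendre_coeff :: "nat \<Rightarrow> real \<Rightarrow> nat \<Rightarrow> real" where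
  "legendre_coeff m a j = inner01 (truncated_taylor m a) (poly (legendre j))"

text \<open>The factor \<open>2 * real j + 1\<close> is the reciprocal of the squared norm of
  \<open>legendre j\<close>, so this is the orthogonal projection of the kernel onto the span of the
  first \<open>n\<close> Legendre polynomials.\<close>

definition legendre_proj :: "nat \<Rightarrow> nat \<Rightarrow> real \<Rightarrow> real poly" where
  "legendre_proj n m a = (\<Sum>j<n. smult ((2 * real j + 1) * legendre_coeff m a j) (legendre j))"

definition residual :: "nat \<Rightarrow> nat \<Rightarrow> real \<Rightarrow> real \<Rightarrow> real" where
  "residual n m a x = truncated_taylor m a x - poly (legendre_proj n m a) x"

lemma residual_L2_01: "residual n m a \<in> L2_01"
  unfolding residual_def[abs_def] by (intro L2_01_diff truncated_taylor_L2_01 poly_L2_01)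

lemma inner01_legendre:
  "inner01 (poly (legendre i)) (poly (legendre j)) = (if i = j then 1 / (2 * j + 1) else 0)"
  using inner01_eqI[OF poly_L2_01 poly_L2_01 legendre_orthogonal, of i j]
    inner01_eqI[OF poly_L2_01 poly_L2_01 legendre_norm, of j] by auto

text \<open>On the Legendre basis the projection has the same coefficients as the kernel;
  \<open>legendre_span\<close> extends this to all polynomials of degree below
  \<open>n\<close>.\<close>

lemma residual_orthogonal_poly:
  assumes "degree p < n"
  shows "inner01 (poly p) (residual n m a) = 0"
proof -
  have leg: "inner01 (poly (legendre j)) (residual n m a) = 0" if j: "j < n" for j
  proof -
    have "inner01 (poly (legendre j)) (residual n m a) = inner01 (residual n m a) (poly (legendre j))"
      by (simp add: mult.commute)
    also have "\<dots> = legendre_coeff m a j - inner01 (poly (legendre_proj n m a)) (poly (legendre j))"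
      unfolding residual_def legendre_coeff_def
      by (intro inner01_diff_left truncated_taylor_L2_01 poly_L2_01)
    also have "inner01 (poly (legendre_proj n m a)) (poly (legendre j))
        = (\<Sum>i<n. (2 * real i + 1) * legendre_coeff m a i * inner01 (poly (legendre i)) (poly (legendre j)))"
      unfolding legendre_proj_def by (rule inner01_poly_sum_left[OF poly_L2_01])
    also have "\<dots> = (\<Sum>i<n. if i = j then legendre_coeff m a i else 0)"
      by (intro sum.cong) (auto simp: inner01_legendre add_eq_0_iff)
    finally show ?thesis using j by simp
  qed
  obtain c where c: "p = (\<Sum>j<n. smult (c j) (legendre j))" using legendre_span[OF assms] by blast
  show ?thesis unfolding c by (subst inner01_poly_sum_left[OF residual_L2_01]) (simp add: leg)
qed

lemma legendre_proj_degree: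
  assumes "n > 0"
  shows "degree (legendre_proj n m a) < n"
proof -
  have "degree (legendre_proj n m a) \<le> n - 1"
    unfolding legendre_proj_def
    by (intro degree_sum_le order_trans[OF degree_smult_le]) (auto simp: degree_legendre)
  then show ?thesis using assms by simp
qed

lemma inner01_residual_self:
  assumes "n > 0"
  shows "inner01 (residual n m a) (residual n m a) = inner01 (truncated_taylor m a) (residual n m a)"
proof -
  have "inner01 (residual n m a) (residual n m a) =
     inner01 (truncated_taylor m a) (residual n m a) - inner01 (poly (legendre_proj n m a)) (residual n m a)"
    by (subst residual_def)
       (intro inner01_diff_left truncated_taylor_L2_01 poly_L2_01 residual_L2_01)
  then show ?thesis using residual_orthogonal_poly[OF legendre_proj_degree[OF assms]] by simp
qed

text \<open>Pythagoras for the projection. In this form, raising \<open>n\<close> by one at fixed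
  \<open>m\<close> subtracts exactly one summand.\<close>

lemma inner01_residual_eq_sum:
  assumes "n > 0"
  shows "inner01 (residual n m a) (residual n m a) =
     inner01 (truncated_taylor m a) (truncated_taylor m a)
     - (\<Sum>j<n. (2 * real j + 1) * (legendre_coeff m a j)\<^sup>2)"
proof -
  have "inner01 (residual n m a) (residual n m a) = inner01 (residual n m a) (truncated_taylor m a)"
    using inner01_residual_self[OF assms] by (simp add: mult.commute)
  also have "\<dots> = inner01 (truncated_taylor m a) (truncated_taylor m a)
      - inner01 (poly (legendre_proj n m a)) (truncated_taylor m a)"
    unfolding residual_def
    by (intro inner01_diff_left truncated_taylor_L2_01 poly_L2_01)
  also have "inner01 (poly (legendre_proj n m a)) (truncated_taylor m a)
      = (\<Sum>j<n. (2 * real j + 1) * legendre_coeff m a j * inner01 (poly (legendre j)) (truncated_taylor m a))"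
    unfolding legendre_proj_def by (rule inner01_poly_sum_left[OF truncated_taylor_L2_01])
  also have "\<dots> = (\<Sum>j<n. (2 * real j + 1) * (legendre_coeff m a j)\<^sup>2)"
    by (intro sum.cong) (auto simp: legendre_coeff_def power2_eq_square mult.commute)
  finally show ?thesis .
qed

text \<open>Since \<open>u\<close> is orthogonal to polynomials of degree below \<open>n\<close>,
  the projection can be subtracted from the kernel without changing the pairing.\<close>

lemma deriv_chain_inner01_residual:
  assumes F: "deriv_chain n F u" and F1: "\<And>j. j < n \<Longrightarrow> F j 1 = 0"
    and m: "m < n" and a: "0 < a" "a < 1" and u: "u \<in> L2_01"
  shows "inner01 (residual n m a) u = F (n - 1 - m) a"
proof -
  have "inner01 (residual n m a) u = inner01 (truncated_taylor m a) u - inner01 (poly (legendre_proj n m a)) u"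
    unfolding residual_def by (intro inner01_diff_left truncated_taylor_L2_01 poly_L2_01 u)
  moreover have "inner01 (poly (legendre_proj n m a)) u = 0"
    using m by (intro inner01_eqI poly_L2_01 u deriv_chain_orthogonal_poly[OF F F1] legendre_proj_degree) auto
  ultimately show ?thesis using deriv_chain_inner01_truncated_taylor[OF F m a u] by simp
qed

subsection \<open>The extremal problem\<close>

lemma AE_lebesgue_on_negligible:
  assumes "AE x in lebesgue_on S. P x" "S \<in> sets lebesgue"
  obtains N where "negligible N" "\<And>x. x \<in> S - N \<Longrightarrow> P x"
proof -
  have "AE x in lebesgue. x \<in> S \<longrightarrow> P x"
    using assms by (subst (asm) AE_restrict_space_iff) auto
  then obtain N where "N \<in> null_sets lebesgue" "{x \<in> space lebesgue. \<not> (x \<in> S \<longrightarrow> P x)} \<subseteq> N"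
    unfolding eventually_ae_filter by blast
  then show ?thesis using that[of N] by (auto simp: negligible_iff_null_sets)
qed

lemma AE_lebesgue_on_neq: "AE x in lebesgue_on {0..1::real}. x \<noteq> a"
proof -
  have "AE x in lebesgue. x \<noteq> a"
    by (rule AE_I'[of "{a}"]) (auto simp: negligible_iff_null_sets[symmetric])
  then show ?thesis by (subst AE_restrict_space_iff) auto
qed

lemma deriv01_has_real_derivative:
  assumes "deriv01 j f differentiable (at x within {0..1})"
  shows "(deriv01 j f has_real_derivative deriv01 (Suc j) f x) (at x within {0..1})"
  using assms vector_derivative_works[of "deriv01 j f" "at x within {0..1}"]
  by (simp add: has_real_derivative_iff_has_vector_derivative)

text \<open>The almost everywhere clause of the space supplies the null set off which
  \<open>deriv01 n f\<close> is a true derivative; on it the value may be unspecified.\<close>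

lemma W2_ring_deriv_chain:
  assumes f: "f \<in> W2_ring n" and n: "n > 0"
  shows "deriv_chain n (\<lambda>j. deriv01 j f) (deriv01 n f)"
proof -
  have "AE x in lebesgue_on {0..1}. deriv01 (n - 1) f differentiable (at x within {0..1})"
    using f by (simp add: W2_ring_def)
  then obtain N where N: "negligible N"
    "\<And>x. x \<in> {0..1} - N \<Longrightarrow> deriv01 (n - 1) f differentiable (at x within {0..1})"
    by (rule AE_lebesgue_on_negligible) auto
  have "(deriv01 (n - 1) f has_real_derivative deriv01 n f x) (at x within {0..1})"
    if "x \<in> {0..1} - N" for x
    using deriv01_has_real_derivative[OF N(2)[OF that]] n by simp
  moreover have "(deriv01 j f has_real_derivative deriv01 (Suc j) f x) (at x within {0..1})"
    if "Suc j < n" "x \<in> {0..1}" for j x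
    using f that by (intro deriv01_has_real_derivative) (auto simp: W2_ring_def)
  ultimately show ?thesis
    using f N(1) unfolding deriv_chain_def by (auto simp: W2_ring_def simp del: deriv01.simps)
qed

section \<open>Building functions of the space from chains\<close>

lemma deriv01_eqI:
  assumes g: "\<And>y. y \<in> {0..1} \<Longrightarrow> deriv01 j f y = g y" and x: "x \<in> {0..1}"
    and der: "(g has_real_derivative d) (at x within {0..1})"
  shows "(deriv01 j f has_real_derivative d) (at x within {0..1})" "deriv01 (Suc j) f x = d"
proof -
  show *: "(deriv01 j f has_real_derivative d) (at x within {0..1})"
    using has_field_derivative_transform_within[OF der zero_less_one x] g by simp
  have "(deriv01 j f has_vector_derivative d) (at x within cbox 0 1)"
    using * by (simp add: has_real_derivative_iff_has_vector_derivative)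
  then show "deriv01 (Suc j) f x = d"
    using vector_derivative_within_cbox[of 0 1 x "deriv01 j f" d] x by simp
qed

lemma abs_continuous_on_cong:
  assumes "\<And>x. x \<in> S \<Longrightarrow> f x = g x"
  shows "abs_continuous_on S f \<longleftrightarrow> abs_continuous_on S g"
proof -
  have "(\<Sum>K\<in>D. \<bar>f (Sup K) - f (Inf K)\<bar>) = (\<Sum>K\<in>D. \<bar>g (Sup K) - g (Inf K)\<bar>)"
    if "D division_of T" "T \<subseteq> S" for D T
    using division_of_real_memD[OF that(1)] that(2) assms by (intro sum.cong) (auto simp: subset_iff)
  then show ?thesis unfolding abs_continuous_on_def by (metis (no_types, lifting))
qed

text \<open>Derivatives within [0, 1] are unique, also at the endpoints, so induction identifies the
  members of a chain. To construct a function of the space it thus suffices to build a chain and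
  take \<open>F 0\<close>.\<close>

lemma deriv_chain_deriv01:
  assumes F: "deriv_chain n F u" and j: "j < n" and x: "x \<in> {0..1}"
  shows "deriv01 j (F 0) x = F j x"
  using j x
proof (induction j arbitrary: x)
  case (Suc j)
  have "(F j has_real_derivative F (Suc j) x) (at x within {0..1})"
    using F Suc.prems unfolding deriv_chain_def by blast
  then show ?case using Suc by (intro deriv01_eqI(2)[where g = "F j"]) auto
qed simp

lemma abs_continuous_on_indefinite_integral:
  fixes g :: "real \<Rightarrow> real"
  assumes g: "g integrable_on {0..1}" and B: "\<And>x. x \<in> {0..1} \<Longrightarrow> \<bar>g x\<bar> \<le> B"
  shows "abs_continuous_on {0..1} (\<lambda>x. integral {0..x} g)"
proof (rule lipschitz_imp_abs_continuous_on)
  have le: "\<bar>integral {0..y} g - integral {0..x} g\<bar> \<le> B * \<bar>y - x\<bar>"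
    if "x \<le> y" "x \<in> {0..1}" "y \<in> {0..1}" for x y
  proof -
    have int: "g integrable_on {0..y}" "g integrable_on {x..y}"
      using that by (auto intro: integrable_on_subinterval[OF g])
    have "integral {0..x} g + integral {x..y} g = integral {0..y} g"
      using that int by (intro Henstock_Kurzweil_Integration.integral_combine) auto
    moreover have "norm (integral {x..y} g) \<le> B * measure lborel (cbox x y)"
    proof (rule has_integral_bound)
      show "0 \<le> B" using order_trans[OF abs_ge_zero B[OF that(2)]] .
      show "(g has_integral integral {x..y} g) (cbox x y)" using integrable_integral[OF int(2)] by simp
      show "norm (g z) \<le> B" if "z \<in> cbox x y" for z
        using B[of z] that \<open>x \<in> {0..1}\<close> \<open>y \<in> {0..1}\<close> by auto
    qed
    ultimately show ?thesis using that by simp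
  qed
  show "\<bar>integral {0..x} g - integral {0..y} g\<bar> \<le> B * \<bar>x - y\<bar>" if "x \<in> {0..1}" "y \<in> {0..1}" for x y
    using le[of x y] le[of y x] that by (cases "x \<le> y") (auto simp: abs_minus_commute)
qed

lemma indefinite_integral_has_real_derivative:
  fixes g :: "real \<Rightarrow> real"
  assumes "g integrable_on {a..b}" "x \<in> {a..b}" "continuous (at x within {a..b}) g"
  shows "((\<lambda>x. integral {a..x} g) has_real_derivative g x) (at x within {a..b})"
  using integral_has_vector_derivative_continuous_at[of g a b x "{}"] assms
  by (simp add: has_real_derivative_iff_has_vector_derivative)

text \<open>Stage \<open>i\<close> is the antiderivative of order \<open>i + 1\<close>, so the
  derivative of order \<open>j\<close> of the \<open>n\<close>-fold one is stage
  \<open>n - 1 - j\<close>.\<close>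

primrec iterated_integral :: "(real \<Rightarrow> real) \<Rightarrow> nat \<Rightarrow> real \<Rightarrow> real" where
  "iterated_integral u 0 = (\<lambda>x. integral {0..x} u)"
| "iterated_integral u (Suc i) = (\<lambda>x. integral {0..x} (iterated_integral u i))"

lemma iterated_integral_deriv_chain:
  assumes u: "u integrable_on {0..1}" and B: "\<And>x. x \<in> {0..1} \<Longrightarrow> \<bar>u x\<bar> \<le> B"
    and cont: "\<And>x. x \<in> {0..1} \<Longrightarrow> x \<noteq> a \<Longrightarrow> continuous (at x within {0..1}) u"
    and n: "n > 0"
  shows "deriv_chain n (\<lambda>j. iterated_integral u (n - 1 - j)) u"
proof -
  have ac: "abs_continuous_on {0..1} (iterated_integral u i)" for i
  proof (induction i)
    case 0
    show ?case using abs_continuous_on_indefinite_integral[OF u B] by simp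
  next
    case (Suc i)
    have c: "continuous_on {0..1} (iterated_integral u i)"
      by (rule abs_continuous_on_imp_continuous_on[OF Suc])
    obtain C where C: "\<And>x. x \<in> {0..1} \<Longrightarrow> \<bar>iterated_integral u i x\<bar> \<le> C"
      using abs_continuous_on_bounded[OF Suc] unfolding bounded_iff
      by (auto simp del: atLeastAtMost_iff)
    then show ?case
      using abs_continuous_on_indefinite_integral[OF integrable_continuous_real[OF c] C] by simp
  qed
  have zero: "iterated_integral u i 0 = 0" for i by (cases i) auto
  have der: "(iterated_integral u (Suc i) has_real_derivative iterated_integral u i x) (at x within {0..1})"
    if "x \<in> {0..1}" for i x
    using integral_has_real_derivative[OF abs_continuous_on_imp_continuous_on[OF ac] that] by simp
  \<comment> \<open>A discontinuity of \<open>u\<close> at \<open>a\<close> affects only the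
    innermost integral; all later stages integrate continuous functions.\<close>
  have der0: "(iterated_integral u 0 has_real_derivative u x) (at x within {0..1})"
    if "x \<in> {0..1} - {a}" for x
    using indefinite_integral_has_real_derivative[OF u _ cont] that by simp
  show ?thesis
    unfolding deriv_chain_def
  proof (intro conjI allI impI ballI)
    fix j x assume j: "Suc j < n" and x: "x \<in> {0..1::real}"
    have "n - 1 - j = Suc (n - 1 - Suc j)" using j by simp
    then show "(iterated_integral u (n - 1 - j) has_real_derivative iterated_integral u (n - 1 - Suc j) x)
       (at x within {0..1})" using der[OF x] by metis
  next
    show "\<exists>N. negligible N \<and> (\<forall>x\<in>{0..1} - N.
        (iterated_integral u (n - 1 - (n - 1)) has_real_derivative u x) (at x within {0..1}))"
      using der0 by (intro exI[of _ "{a}"]) auto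
  qed (use ac zero in auto)
qed

lemma residual_bounded_01:
  obtains B where "\<And>x. x \<in> {0..1} \<Longrightarrow> \<bar>residual n m a x\<bar> \<le> B"
proof -
  obtain B where B: "\<And>x. x \<in> {0..1} \<Longrightarrow> \<bar>truncated_taylor m a x\<bar> \<le> B"
    using truncated_taylor_bounded_01 by blast
  obtain C where C: "\<And>x. x \<in> {0..1} \<Longrightarrow> \<bar>poly (legendre_proj n m a) x\<bar> \<le> C"
    using poly_bounded_01 by blast
  have "\<bar>residual n m a x\<bar> \<le> B + C" if "x \<in> {0..1}" for x
    using B[OF that] C[OF that] by (simp add: residual_def)
  then show ?thesis using that by blast
qed

lemma residual_isCont: "x \<noteq> a \<Longrightarrow> isCont (residual n m a) x"
  unfolding residual_def[abs_def] by (intro continuous_intros truncated_taylor_isCont)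

text \<open>The \<open>n\<close>-fold antiderivative of a multiple of the residual lies in the space: orthogonality to
  polynomials of degree less than \<open>n\<close> is what makes it vanish to order \<open>n\<close> at \<open>1\<close>.\<close>
lemma W2_ring_antiderivative_residual:
  fixes s :: real
  assumes n: "n > 0" and a: "0 < a" "a < 1" and m: "m < n"
  shows "\<exists>f \<in> W2_ring n. (\<forall>x\<in>{0..1} - {a}. deriv01 n f x = s * residual n m a x) \<and>
     deriv01 (n - 1 - m) f a = s * inner01 (residual n m a) (residual n m a)"
proof -
  define u where "u x = s * residual n m a x" for x
  define F where "F j = iterated_integral u (n - 1 - j)" for j
  have uL: "u \<in> L2_01" unfolding u_def[abs_def] by (rule L2_01_cmult[OF residual_L2_01])
  \<comment> \<open>Integrability of \<open>u\<close> follows from square integrability by pairing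
    with the constant polynomial 1.\<close>
  have "(\<lambda>x. poly 1 x * u x) integrable_on {0..1}"
    using L2_01_mult_integrable[OF poly_L2_01 uL, of 1] by (intro integrable_on_lebesgue_on) auto
  then have uint: "u integrable_on {0..1}" by simp
  have ucont: "continuous (at x within {0..1}) u" if "x \<noteq> a" for x
    unfolding u_def[abs_def]
    by (rule continuous_at_imp_continuous_at_within)
       (rule continuous_mult[OF continuous_const residual_isCont[OF that]])
  have chain: "deriv_chain n F u"
  proof -
    obtain B where B: "\<And>x. x \<in> {0..1} \<Longrightarrow> \<bar>residual n m a x\<bar> \<le> B" using residual_bounded_01 by blast
    have "\<bar>u x\<bar> \<le> \<bar>s\<bar> * B" if "x \<in> {0..1}" for x
      using B[OF that] by (simp add: u_def abs_mult mult_left_mono)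
    then show ?thesis
      unfolding F_def[abs_def] using iterated_integral_deriv_chain[OF uint _ ucont n] by blast
  qed
  have orth: "inner01 (poly p) u = 0" if "degree p < n" for p
  proof -
    have "inner01 (poly p) u = (\<integral>x. s * (poly p x * residual n m a x) \<partial>lebesgue_on {0..1})"
      by (simp add: u_def ac_simps)
    also have "\<dots> = s * inner01 (poly p) (residual n m a)"
      by simp
    finally show ?thesis using residual_orthogonal_poly[OF that] by simp
  qed
  have F1: "F j 1 = 0" if "j < n" for j
  proof -
    \<comment> \<open>By Taylor's formula at 1, \<open>F j 1\<close> is the pairing of
      \<open>u\<close> with a polynomial of degree \<open>n - 1 - j\<close>, which is below
      \<open>n\<close>.\<close>
    have "inner01 (poly (taylor_poly (n - 1 - j) 1)) u = F (n - 1 - (n - 1 - j)) 1"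
      using that by (intro inner01_eqI poly_L2_01 uL deriv_chain_taylor[OF chain]) auto
    then show ?thesis using orth[of "taylor_poly (n - 1 - j) 1"] that by (simp add: degree_taylor_poly)
  qed
  have F0: "F j 0 = 0" and Fac: "abs_continuous_on {0..1} (F j)" if "j < n" for j
    using chain that unfolding deriv_chain_def by auto
  have Fder: "(F j has_real_derivative F (Suc j) x) (at x within {0..1})" if "Suc j < n" "x \<in> {0..1}" for j x
    using chain that unfolding deriv_chain_def by auto
  define f where "f = F 0"
  have dF: "deriv01 j f x = F j x" if "j < n" "x \<in> {0..1}" for j x
    unfolding f_def by (rule deriv_chain_deriv01[OF chain that])
  have Flast: "(F (n - 1) has_real_derivative u x) (at x within {0..1})" if "x \<in> {0..1} - {a}" for x
    using indefinite_integral_has_real_derivative[OF uint _ ucont] that by (simp add: F_def)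
  have last: "(deriv01 (n - 1) f has_real_derivative u x) (at x within {0..1})" "deriv01 n f x = u x"
    if "x \<in> {0..1} - {a}" for x
    using deriv01_eqI[of "n - 1" f "F (n - 1)" x "u x", OF dF _ Flast[OF that]] that n by auto
  have "f \<in> W2_ring n"
    unfolding W2_ring_def
  proof (intro CollectI conjI allI impI ballI)
    fix j and x :: real assume j: "j < n - 1" and x: "x \<in> {0..1}"
    have "(deriv01 j f has_real_derivative F (Suc j) x) (at x within {0..1})"
      using j x by (intro deriv01_eqI(1)[OF dF] Fder) auto
    then show "deriv01 j f differentiable (at x within {0..1})"
      using real_differentiable_def by blast
  next
    fix j assume "j < n"
    then show "abs_continuous_on {0..1} (deriv01 j f)" "deriv01 j f 0 = 0" "deriv01 j f 1 = 0"
      using Fac dF F0 F1 abs_continuous_on_cong[of "{0..1}" "deriv01 j f" "F j"] by auto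
  next
    have diff: "deriv01 (n - 1) f differentiable (at x within {0..1})" if "x \<in> {0..1} - {a}" for x
      using last(1)[OF that] real_differentiable_def by blast
    show "AE x in lebesgue_on {0..1}. deriv01 (n - 1) f differentiable (at x within {0..1})"
      using AE_lebesgue_on_neq[of a] AE_space[of "lebesgue_on {0..1::real}"]
      by eventually_elim (use diff in auto)
  next
    \<comment> \<open>At \<open>a\<close> the derivative may fail to exist and
      \<open>deriv01 n f a\<close> is then unspecified; changing one value affects neither
      measurability nor the integral.\<close>
    have eq: "deriv01 n f x = (if x = a then deriv01 n f a else u x)" if "x \<in> {0..1}" for x
      using last(2)[of x] that by auto
    have "{x \<in> space (lebesgue_on {0..1}). x = a} = {a}" using a by auto
    then have "(\<lambda>x. if x = a then deriv01 n f a else u x) \<in> borel_measurable (lebesgue_on {0..1})"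
      using uL a by (intro measurable_If) (auto simp: L2_01_def sets_restrict_space_iff)
    then have meas: "deriv01 n f \<in> borel_measurable (lebesgue_on {0..1})"
      using eq by (subst measurable_cong[where g = "\<lambda>x. if x = a then deriv01 n f a else u x"]) auto
    have "AE x in lebesgue_on {0..1}. (deriv01 n f x)\<^sup>2 = (u x)\<^sup>2"
      using AE_lebesgue_on_neq[of a] AE_space[of "lebesgue_on {0..1::real}"]
      by eventually_elim (use last(2) in auto)
    then have "integrable (lebesgue_on {0..1}) (\<lambda>x. (deriv01 n f x)\<^sup>2)"
      using uL meas
      by (subst integrable_cong_AE[where g = "\<lambda>x. (u x)\<^sup>2"]) (auto simp: L2_01_def)
    then show "deriv01 n f \<in> L2_01" using meas by (simp add: L2_01_def)
  qed
  moreover have "deriv01 (n - 1 - m) f a = s * inner01 (residual n m a) (residual n m a)"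
  proof -
    have "deriv01 (n - 1 - m) f a = F (n - 1 - m) a" using n a by (intro dF) auto
    also have "\<dots> = inner01 (residual n m a) u"
      by (rule deriv_chain_inner01_residual[OF chain F1 m a uL, symmetric])
    also have "\<dots> = (\<integral>x. s * (residual n m a x * residual n m a x) \<partial>lebesgue_on {0..1})"
      by (simp add: u_def ac_simps)
    finally show ?thesis by simp
  qed
  ultimately show ?thesis using last(2) unfolding u_def by blast
qed

section \<open>The extremal value and the difference formula\<close>

text \<open>The derivative at \<open>a\<close> is the pairing of the residual \<open>r\<close> with
  the \<open>n\<close>-th derivative. Cauchy-Schwarz bounds it by the norm of \<open>r\<close>, and
  an \<open>n\<close>-fold antiderivative of \<open>r\<close> divided by its norm attains the
  bound.\<close>

lemma A_const_eq_residual_norm: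
  assumes k: "k < n" and a: "0 < a" "a < 1"
  shows "A_const n k a = ereal (sqrt (inner01 (residual n (n - 1 - k) a) (residual n (n - 1 - k) a)))"
proof -
  define r where "r = residual n (n - 1 - k) a"
  define V where "V = inner01 r r"
  have n: "n > 0" and m: "n - 1 - k < n" and k': "n - 1 - (n - 1 - k) = k" using k by auto
  have rL: "r \<in> L2_01" unfolding r_def by (rule residual_L2_01)
  have V0: "V \<ge> 0" unfolding V_def by (intro Bochner_Integration.integral_nonneg) simp
  have "A_const n k a = ereal (sqrt V)"
    unfolding A_const_def
  proof (rule antisym)
    show "(SUP f\<in>{f \<in> W2_ring n. (\<integral>x. \<bar>deriv01 n f x\<bar>\<^sup>2 \<partial>lebesgue_on {0..1}) \<le> 1}.
        ereal \<bar>deriv01 k f a\<bar>) \<le> ereal (sqrt V)"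
    proof (rule SUP_least, clarify)
      fix f assume f: "f \<in> W2_ring n" and le: "(\<integral>x. \<bar>deriv01 n f x\<bar>\<^sup>2 \<partial>lebesgue_on {0..1}) \<le> 1"
      have u: "deriv01 n f \<in> L2_01" and f1: "\<And>j. j < n \<Longrightarrow> deriv01 j f 1 = 0"
        using f by (auto simp: W2_ring_def)
      have "inner01 r (deriv01 n f) = deriv01 k f a"
        using deriv_chain_inner01_residual[OF W2_ring_deriv_chain[OF f n] f1 m a u]
        unfolding r_def k' .
      then have "(deriv01 k f a)\<^sup>2 \<le> V"
        using inner01_bessel[OF u rL] le by (simp add: V_def power2_eq_square)
      then show "ereal \<bar>deriv01 k f a\<bar> \<le> ereal (sqrt V)"
        using real_le_rsqrt[of "\<bar>deriv01 k f a\<bar>" V] by simp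
    qed
    \<comment> \<open>If \<open>V = 0\<close> then \<open>1 / sqrt V = 0\<close> and the extremal function degenerates to \<open>0\<close>, as it should.\<close>
    define s where "s = 1 / sqrt V"
    obtain f where f: "f \<in> W2_ring n" "\<And>x. x \<in> {0..1} - {a} \<Longrightarrow> deriv01 n f x = s * r x"
      "deriv01 k f a = s * V"
      using W2_ring_antiderivative_residual[OF n a m, of s] unfolding r_def V_def k' by blast
    have "(\<integral>x. \<bar>deriv01 n f x\<bar>\<^sup>2 \<partial>lebesgue_on {0..1}) = (\<integral>x. s\<^sup>2 * (r x * r x) \<partial>lebesgue_on {0..1})"
    proof (rule integral_cong_AE)
      show "AE x in lebesgue_on {0..1}. \<bar>deriv01 n f x\<bar>\<^sup>2 = s\<^sup>2 * (r x * r x)"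
        using AE_lebesgue_on_neq[of a] AE_space[of "lebesgue_on {0..1::real}"]
        by eventually_elim (use f(2) in \<open>auto simp: power_mult_distrib power2_eq_square\<close>)
    qed (use f(1) rL in \<open>auto simp: W2_ring_def L2_01_def\<close>)
    also have "\<dots> = s\<^sup>2 * V" by (simp add: V_def)
    also have "\<dots> \<le> 1" using V0 by (simp add: s_def power_divide)
    finally have "f \<in> {f \<in> W2_ring n. (\<integral>x. \<bar>deriv01 n f x\<bar>\<^sup>2 \<partial>lebesgue_on {0..1}) \<le> 1}" using f(1) by simp
    then have "ereal \<bar>deriv01 k f a\<bar> \<le> (SUP f\<in>{f \<in> W2_ring n. (\<integral>x. \<bar>deriv01 n f x\<bar>\<^sup>2 \<partial>lebesgue_on {0..1}) \<le> 1}.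
        ereal \<bar>deriv01 k f a\<bar>)"
      by (rule SUP_upper)
    moreover have "\<bar>deriv01 k f a\<bar> = sqrt V"
      using V0 by (simp add: f(3) s_def real_div_sqrt)
    ultimately show "ereal (sqrt V) \<le> (SUP f\<in>{f \<in> W2_ring n. (\<integral>x. \<bar>deriv01 n f x\<bar>\<^sup>2 \<partial>lebesgue_on {0..1}) \<le> 1}.
        ereal \<bar>deriv01 k f a\<bar>)" by simp
  qed
  then show ?thesis by (simp add: V_def r_def)
qed

lemma A_const_square:
  assumes "k < n" "0 < a" "a < 1"
  shows "(A_const n k a)\<^sup>2 = ereal (inner01 (truncated_taylor (n - 1 - k) a) (truncated_taylor (n - 1 - k) a)
     - (\<Sum>j<n. (2 * real j + 1) * (legendre_coeff (n - 1 - k) a j)\<^sup>2))"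
proof -
  have "0 \<le> inner01 (residual n (n - 1 - k) a) (residual n (n - 1 - k) a)"
    by (intro Bochner_Integration.integral_nonneg) simp
  then have "(A_const n k a)\<^sup>2 = ereal (inner01 (residual n (n - 1 - k) a) (residual n (n - 1 - k) a))"
    unfolding A_const_eq_residual_norm[OF assms] by (simp only: ereal_power real_sqrt_pow2)
  then show ?thesis using assms(1) by (subst (asm) inner01_residual_eq_sum) auto
qed

text \<open>Taylor's formula for the chain of \<open>legendre_base j\<close>: the pairing gives its
  derivative of order \<open>j - 1 - m\<close>, that is, the antiderivative of order
  \<open>Suc m\<close> of the Legendre polynomial.\<close>

lemma legendre_coeff_eq_antideriv:
  assumes "m < j" "0 < a" "a < 1"
  shows "legendre_coeff m a j = legendre_antideriv j (Suc m) a"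
  using deriv_chain_inner01_truncated_taylor[OF legendre_deriv_chain assms poly_L2_01] assms(1)
  by (simp add: legendre_coeff_def legendre_antideriv_eq_poly)

theorem mainTheorem2:
  fixes n k :: nat and a :: real
  assumes "n \<ge> 2" and "1 \<le> k" and "k \<le> n - 1" and "0 < a" and "a < 1"
  shows "(A_const n k a)\<^sup>2 - (A_const (n - 1) (k - 1) a)\<^sup>2
       = ereal (- (2 * real n - 1) * (legendre_antideriv (n - 1) (n - k) a)\<^sup>2)"
proof -
  obtain N where N: "n = Suc N" using assms(1) by (cases n) auto
  \<comment> \<open>Both pairs \<open>(n, k)\<close> and \<open>(n - 1, k - 1)\<close> have this
    same \<open>m\<close>, hence the same kernel and the same coefficients.\<close>
  define m where "m = n - 1 - k"
  have m: "N - 1 - (k - 1) = m" "m < N" "Suc m = n - k" using assms N by (auto simp: m_def)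
  have "legendre_coeff m a N = legendre_antideriv N (n - k) a"
    using legendre_coeff_eq_antideriv[OF m(2) assms(4,5)] by (simp only: m(3))
  moreover have "k < n" "k - 1 < N" using assms N by auto
  \<comment> \<open>Both squares are finite, so the difference is one of reals. The kernel norm and
    the first \<open>N\<close> summands cancel; the summand at \<open>N\<close> remains, with factor
    2N + 1 = 2n - 1.\<close>
  note A_const_square[OF this(1) assms(4,5), folded m_def] A_const_square[OF this(2) assms(4,5), unfolded m(1)]
  ultimately show ?thesis by (simp add: N algebra_simps)
qed

end
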